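(* Let $P\subset\mathbb{R}^d$ be a polyhedral set with non-empty interior. Fix $k\in\{1,\dots,d\}$ and let $A:\mathbb{R}^d\to\mathbb{R}^k$ be a linear map of full rank $k$. (a) If $F$ is a proper face of $AP$, then $F=AG$ for a proper face $G$ of $P$ with $\dim G\ge\dim F$. (b) If, moreover, $\ker A$ is in general position with respect to $P$, then $\dim F=\dim G$. Also, $G$ is unique in the following sense: if $G'$ is a face of $P$ satisfying $AG'=F$, then $G'=G$.
   Context: A polyhedral set is an intersection of finitely many closed half-spaces (whose boundaries need not pass through the origin). Faces of $P$ include $P$ itself; proper faces are the non-empty faces different from the set itself, i.e. the intersections with supporting hyperplanes. The dimension of a convex set is the dimension of its affine hull. General position: for a convex set $M\subset\mathbb{R}^d$ let $L$ be the linear subspace with $\mathrm{aff}\,M=t+L$ for some $t\in\mathbb{R}^d$. $M$ is in general position with respect to a linear subspace $L'\subset\mathbb{R}^d$ if $\dim(L\cap L')=\max(\dim L-\mathrm{codim}\,L',0)$. A linear subspace $L'$ is in general position with respect to a polyhedral set $P$ if it is in general position with respect to all faces of $P$ of all dimensions. *)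

theory Defs
  imports "HOL-Analysis.Analysis"
begin

text \<open>The library relation \<open>face_of\<close> counts the empty set and the whole set as faces.\<close>

definition proper_face :: "'a::real_vector set \<Rightarrow> 'a set \<Rightarrow> bool" where
  "proper_face F P \<longleftrightarrow> F face_of P \<and> F \<noteq> {} \<and> F \<noteq> P"

text \<open>
  The proper faces of a polyhedral set with non-empty interior are exactly its non-empty
  intersections with supporting hyperplanes.
\<close>

lemma proper_face_iff_supporting_hyperplane:
  fixes P :: "'a::euclidean_space set"
  assumes "polyhedron P" and "interior P \<noteq> {}"
  shows "proper_face F P \<longleftrightarrow>
    F \<noteq> {} \<and> (\<exists>a b. a \<noteq> 0 \<and> P \<subseteq> {x. a \<bullet> x \<le> b} \<and> F = P \<inter> {x. a \<bullet> x = b})"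
proof
  assume l: "proper_face F P"
  then have "F exposed_face_of P"
    using assms(1) exposed_face_of_polyhedron unfolding proper_face_def by blast
  then obtain a b where ab: "P \<subseteq> {x. a \<bullet> x \<le> b}" "F = P \<inter> {x. a \<bullet> x = b}"
    unfolding exposed_face_of_def by blast
  moreover have "a \<noteq> 0"
    using l ab unfolding proper_face_def by auto
  ultimately show "F \<noteq> {} \<and> (\<exists>a b. a \<noteq> 0 \<and> P \<subseteq> {x. a \<bullet> x \<le> b} \<and> F = P \<inter> {x. a \<bullet> x = b})"
    using l unfolding proper_face_def by blast
next
  assume r: "F \<noteq> {} \<and> (\<exists>a b. a \<noteq> 0 \<and> P \<subseteq> {x. a \<bullet> x \<le> b} \<and> F = P \<inter> {x. a \<bullet> x = b})"
  then obtain a b where ab: "a \<noteq> 0" "P \<subseteq> {x. a \<bullet> x \<le> b}" "F = P \<inter> {x. a \<bullet> x = b}"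
    by blast
  have "F face_of P"
    using ab face_of_Int_supporting_hyperplane_le [OF polyhedron_imp_convex [OF assms(1)]]
    by blast
  moreover have "F \<noteq> P"
  proof
    assume "F = P"
    then have "interior P \<subseteq> interior {x. a \<bullet> x = b}"
      using ab by (intro interior_mono) blast
    then show False
      using assms(2) ab(1) by simp
  qed
  ultimately show "proper_face F P"
    using r unfolding proper_face_def by blast
qed

definition codim :: "'a::euclidean_space set \<Rightarrow> int" where
  "codim L = int DIM('a) - int (dim L)"

text \<open>
  For non-empty \<open>M\<close> the direction space \<open>L\<close> below exists and is unique; for empty \<open>M\<close> there is none.
\<close>

definition in_general_position :: "'a::euclidean_space set \<Rightarrow> 'a set \<Rightarrow> bool" where
  "in_general_position M L' \<longleftrightarrow>
    (\<exists>L t. subspace L \<and> affine hull M = (+) t ` L \<and>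
       int (dim (L \<inter> L')) = max (int (dim L) - codim L') 0)"

definition general_position_polyhedral :: "'a::euclidean_space set \<Rightarrow> 'a set \<Rightarrow> bool" where
  "general_position_polyhedral L' P \<longleftrightarrow>
    (\<forall>F. F face_of P \<and> F \<noteq> {} \<longrightarrow> in_general_position F L')"

end

theory Submission
  imports Defs
begin

text \<open>
  A face \<open>F\<close> of \<open>A ` P\<close> pulls back to the face \<open>P \<inter> A -` F\<close> of \<open>P\<close>, whose image is \<open>F\<close>. Since a linear
  map does not raise dimensions, this pullback witnesses the first part of the theorem.

  By rank-nullity, general position of the kernel says that \<open>A\<close> maps each face \<open>G\<close> to a set of dimension
  \<open>min (aff_dim G) (rank A)\<close> (\<open>aff_dim_linear_image_general_position\<close>). If \<open>A ` G\<close> is a proper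
  face of \<open>A ` P\<close>, its dimension is below that of \<open>A ` P\<close>, hence below the rank, so the minimum is
  attained by \<open>aff_dim G\<close> and \<open>A\<close> preserves the dimension of \<open>G\<close>. Uniqueness follows by comparison with
  the pullback: each face \<open>G\<close> with image \<open>F\<close> is a face of \<open>P \<inter> A -` F\<close>, both have the
  dimension of \<open>F\<close>, and a face that has the dimension of the whole convex set is the whole set.
\<close>

text \<open>
  Rank-nullity for a linear map restricted to a subspace: on the orthogonal complement, within \<open>L\<close>, of
  the kernel of the restriction, \<open>f\<close> is injective and already has the image \<open>f ` L\<close>.
\<close>

lemma dim_linear_image_plus_dim_kernel:
  fixes f :: "'a::euclidean_space \<Rightarrow> 'b::euclidean_space"
  assumes f: "linear f" and L: "subspace L"
  shows "dim (f ` L) + dim (L \<inter> {x. f x = 0}) = dim L"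
proof -
  define N where "N = L \<inter> {x. f x = 0}"
  define W where "W = {y \<in> L. \<forall>x \<in> N. orthogonal x y}"
  have N: "subspace N"
    unfolding N_def by (intro subspace_inter L linear_subspace_kernel f)
  have NL: "N \<subseteq> L"
    unfolding N_def by blast
  have W: "subspace W"
    using L unfolding W_def subspace_def
    by (auto simp: orthogonal_def inner_add_right)
  have eqW: "f ` L = f ` W"
  proof
    show "f ` L \<subseteq> f ` W"
    proof
      fix z assume "z \<in> f ` L"
      then obtain x where x: "x \<in> L" "z = f x"
        by blast
      obtain y w where y: "y \<in> span N" and w: "\<And>u. u \<in> span N \<Longrightarrow> orthogonal w u"
        and xyw: "x = y + w"
        using orthogonal_subspace_decomp_exists [of N x] by blast
      have yN: "y \<in> N"
        using y N by (metis span_eq_iff)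
      have "w = x - y"
        using xyw by simp
      then have "w \<in> L"
        using x(1) yN NL L subspace_diff by blast
      then have "w \<in> W"
        using w unfolding W_def by (simp add: orthogonal_commute span_base)
      moreover have "f x = f w"
        using xyw yN f unfolding N_def by (simp add: linear_add)
      ultimately show "z \<in> f ` W"
        using x by blast
    qed
  qed (auto simp: W_def)
  have "inj_on f (span W)"
  proof (rule inj_onI)
    fix x y assume "x \<in> span W" "y \<in> span W" and eq: "f x = f y"
    then have d: "x - y \<in> W"
      using W by (metis span_eq_iff subspace_diff)
    then have "x - y \<in> N"
      using eq f unfolding N_def W_def by (simp add: linear_diff)
    then show "x = y"
      using d unfolding W_def by (auto simp: orthogonal_def)
  qed
  then have "dim (f ` W) = dim W"
    by (rule dim_image_eq [OF f])
  then show ?thesis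
    using dim_subspace_orthogonal_to_vectors [OF N L NL] eqW
    unfolding W_def N_def by simp
qed

lemma aff_dim_affine_hull_translation_subspace:
  fixes M :: "'a::euclidean_space set"
  assumes "affine hull M = (+) t ` L" and "subspace L"
  shows "aff_dim M = int (dim L)"
  using assms by (metis aff_dim_affine_hull aff_dim_translation_eq aff_dim_subspace)

lemma aff_dim_linear_image_le_rank:
  fixes f :: "'a::euclidean_space \<Rightarrow> 'b::euclidean_space"
  assumes "linear f"
  shows "aff_dim (f ` M) \<le> int (dim (range f))"
proof -
  have "aff_dim (f ` M) \<le> aff_dim (range f)"
    by (intro aff_dim_subset image_mono subset_UNIV)
  also have "\<dots> = int (dim (range f))"
    by (intro aff_dim_subspace linear_subspace_image assms subspace_UNIV)
  finally show ?thesis .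
qed

text \<open>
  The codimension of the kernel is the rank, so general position says that the kernel meets the
  direction space of \<open>M\<close> in the smallest dimension that rank-nullity allows.
\<close>

lemma aff_dim_linear_image_general_position:
  fixes f :: "'a::euclidean_space \<Rightarrow> 'b::euclidean_space"
  assumes f: "linear f" and gp: "in_general_position M {x. f x = 0}"
  shows "aff_dim (f ` M) = min (aff_dim M) (int (dim (range f)))"
proof -
  obtain L t where L: "subspace L" and hull: "affine hull M = (+) t ` L"
    and d: "int (dim (L \<inter> {x. f x = 0})) = max (int (dim L) - codim {x. f x = 0}) 0"
    using gp unfolding in_general_position_def by blast
  have "codim {x. f x = 0} = int (dim (range f))"
    using dim_linear_image_plus_dim_kernel [OF f subspace_UNIV] unfolding codim_def by simp
  moreover have "int (dim (f ` L)) = int (dim L) - int (dim (L \<inter> {x. f x = 0}))"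
    using dim_linear_image_plus_dim_kernel [OF f L] by linarith
  ultimately have "int (dim (f ` L)) = min (int (dim L)) (int (dim (range f)))"
    using d by linarith
  moreover have "affine hull (f ` M) = (+) (f t) ` f ` L"
    using affine_hull_linear_image [of f M] f hull
    by (auto simp: linear_conv_bounded_linear [symmetric] image_image linear_add)
  ultimately show ?thesis
    using aff_dim_affine_hull_translation_subspace [OF hull L]
      aff_dim_affine_hull_translation_subspace [OF _ linear_subspace_image [OF f L], of "f ` M"]
    by simp
qed

text \<open>
  A segment of \<open>P\<close> through a point over \<open>F\<close> maps to a segment of \<open>f ` P\<close> through a point of \<open>F\<close>, or
  collapses to that point; in both cases its endpoints lie over \<open>F\<close>.
\<close>

lemma face_of_Int_linear_vimage:
  assumes f: "linear f" and P: "convex P" and F: "F face_of f ` P"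
  shows "(P \<inter> f -` F) face_of P"
  unfolding face_of_def
proof (intro conjI ballI impI)
  show "convex (P \<inter> f -` F)"
    using convex_linear_vimage [OF f face_of_imp_convex [OF F]] P by (rule convex_Int [rotated])
next
  fix a b x
  assume ab: "a \<in> P" "b \<in> P" and x: "x \<in> P \<inter> f -` F" and seg: "x \<in> open_segment a b"
  obtain u where u: "0 < u" "u < 1" "x = (1 - u) *\<^sub>R a + u *\<^sub>R b"
    using seg unfolding in_segment by blast
  have fx: "f x = (1 - u) *\<^sub>R f a + u *\<^sub>R f b"
    using u(3) f by (simp add: linear_add linear_scale)
  have "f a \<in> F \<and> f b \<in> F"
  proof (cases "f a = f b")
    case True
    then have "f x = f a"
      using fx by (simp add: algebra_simps)
    then show ?thesis
      using x True by simp
  next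
    case False
    then have "f x \<in> open_segment (f a) (f b)"
      using fx u unfolding in_segment by blast
    then show ?thesis
      using face_ofD [OF F] ab x by blast
  qed
  then show "a \<in> P \<inter> f -` F" and "b \<in> P \<inter> f -` F"
    using ab by auto
qed auto

text \<open>
  A proper face of \<open>f ` P\<close> has dimension below the rank of \<open>f\<close>, so the rank does not cap the
  dimension of \<open>f ` G\<close>, and general position leaves \<open>aff_dim G\<close> as its only other value.
\<close>

lemma aff_dim_eq_if_image_proper_face:
  fixes f :: "'a::euclidean_space \<Rightarrow> 'b::euclidean_space"
  assumes f: "linear f" and P: "convex P"
    and gp: "general_position_polyhedral {x. f x = 0} P"
    and F: "proper_face (f ` G) (f ` P)" and G: "G face_of P"
  shows "aff_dim (f ` G) = aff_dim G"
proof -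
  have "aff_dim (f ` G) < aff_dim (f ` P)"
    using F face_of_aff_dim_lt [OF convex_linear_image [OF f P]] unfolding proper_face_def by blast
  also have "\<dots> \<le> int (dim (range f))"
    by (rule aff_dim_linear_image_le_rank [OF f])
  finally have "aff_dim (f ` G) < int (dim (range f))" .
  moreover have "in_general_position G {x. f x = 0}"
    using gp F G unfolding general_position_polyhedral_def proper_face_def by blast
  ultimately show ?thesis
    using aff_dim_linear_image_general_position [OF f] by fastforce
qed

text \<open>
  The face over \<open>F\<close> is the largest one with image \<open>F\<close>; a smaller one would have
  smaller dimension, whereas \<open>F\<close> determines the dimension.
\<close>

lemma face_eq_Int_vimage_if_general_position:
  fixes f :: "'a::euclidean_space \<Rightarrow> 'b::euclidean_space"
  assumes f: "linear f" and P: "convex P"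
    and gp: "general_position_polyhedral {x. f x = 0} P"
    and F: "proper_face F (f ` P)" and G: "G face_of P" "f ` G = F"
  shows "G = P \<inter> f -` F"
proof (rule ccontr)
  let ?H = "P \<inter> f -` F"
  assume ne: "G \<noteq> ?H"
  have H: "?H face_of P"
    using face_of_Int_linear_vimage [OF f P] F unfolding proper_face_def by blast
  have sub: "G \<subseteq> ?H"
    using G face_of_imp_subset by blast
  then have "f ` ?H = F"
    using G(2) by blast
  then have "aff_dim G = aff_dim ?H"
    using aff_dim_eq_if_image_proper_face [OF f P gp] F G H by metis
  moreover have "G face_of ?H"
    using face_of_subset [OF G(1) sub] by blast
  then have "aff_dim G < aff_dim ?H"
    using face_of_aff_dim_lt [OF face_of_imp_convex [OF H]] ne by blast
  ultimately show False
    by simp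
qed

theorem proposition5p2:
  fixes P :: "(real ^ 'd) set"
    and A :: "real ^ 'd \<Rightarrow> real ^ 'k"
  assumes "polyhedron P"
    and "interior P \<noteq> {}"
    and "CARD('k) \<le> CARD('d)"
    and "linear A"
    and "dim (range A) = CARD('k)"
  shows
    "(\<forall>F. proper_face F (A ` P) \<longrightarrow>
        (\<exists>G. proper_face G P \<and> F = A ` G \<and> aff_dim G \<ge> aff_dim F)) \<and>
     (general_position_polyhedral {x. A x = 0} P \<longrightarrow>
        (\<forall>F G. proper_face F (A ` P) \<and> proper_face G P \<and> F = A ` G \<longrightarrow>
           aff_dim F = aff_dim G \<and>
           (\<forall>G'. G' face_of P \<and> A ` G' = F \<longrightarrow> G' = G)))"
proof (intro conjI allI impI)
  have P: "convex P"
    using assms(1) by (rule polyhedron_imp_convex)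
  note A = assms(4)
  show "\<exists>G. proper_face G P \<and> F = A ` G \<and> aff_dim G \<ge> aff_dim F"
    if F: "proper_face F (A ` P)" for F
  proof (intro exI conjI)
    let ?G = "P \<inter> A -` F"
    have "F \<subseteq> A ` P"
      using F face_of_imp_subset unfolding proper_face_def by blast
    then show im: "F = A ` ?G"
      by blast
    then show "proper_face ?G P"
      using face_of_Int_linear_vimage [OF A P] F unfolding proper_face_def by auto
    show "aff_dim F \<le> aff_dim ?G"
      using aff_dim_linear_image_le [OF A, of ?G] im by simp
  qed
  fix F G
  assume gp: "general_position_polyhedral {x. A x = 0} P"
    and FG: "proper_face F (A ` P) \<and> proper_face G P \<and> F = A ` G"
  then have G: "G face_of P"
    unfolding proper_face_def by blast
  show "aff_dim F = aff_dim G"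
    using aff_dim_eq_if_image_proper_face [OF A P gp _ G] FG by blast
  show "G' = G" if "G' face_of P \<and> A ` G' = F" for G'
    using face_eq_Int_vimage_if_general_position [OF A P gp] that FG G by metis
qed

end
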